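(* Let $m\ge 2$ be even and $n\ge 1$, let $\mathcal{A}\in\mathbb{R}^{[n,m]}$ be a real symmetric tensor of order $m$ and dimension $n$, and put $d=n(m-1)^{n-1}$. Suppose that the $d$ eigenvalues of $\mathcal{A}$ (counted with multiplicity) are all real and positive, ordered as $\lambda_1\ge\lambda_2\ge\cdots\ge\lambda_d>0$. Let $k$ be an integer with $1\le k\le d-1$. Then $$\lambda_1+\cdots+\lambda_k\le (m-1)^{n-1}\operatorname{tr}(\mathcal{A})-(d-k)\left[\left(\frac{k}{(m-1)^{n-1}\operatorname{tr}(\mathcal{A})}\right)^{k}\det(\mathcal{A})\right]^{1/(d-k)}$$ and $$\lambda_{d-k+1}\cdots\lambda_d\ge\left(\frac{d-k}{(m-1)^{n-1}\operatorname{tr}(\mathcal{A})}\right)^{d-k}\det(\mathcal{A}).$$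
   Context: $\mathbb{R}^{[n,m]}$ is the set of real tensors $\mathcal{A}=(a_{i_1\cdots i_m})_{1\le i_1,\dots,i_m\le n}$ of order $m$ and dimension $n$. $\mathcal{A}$ is symmetric if its entries are invariant under every permutation of the indices. For a vector $x$, $\mathcal{A}x^{m-1}$ is the vector with $i$-th component $\sum_{i_2,\dots,i_m=1}^n a_{i i_2\cdots i_m}x_{i_2}\cdots x_{i_m}$. The identity tensor $\mathcal{I}$ has entry $1$ when $i_1=\cdots=i_m$ and $0$ otherwise. The trace $\operatorname{tr}(\mathcal{A})=\sum_{i=1}^n a_{ii\cdots i}$ is the sum of the diagonal entries. The resultant of $n$ homogeneous polynomials $f_1,\dots,f_n$ in $n$ variables of degrees $d_1,\dots,d_n$ is the unique polynomial in their coefficients such that (1) it vanishes if and only if $f_1=\cdots=f_n=0$ has a nonzero (complex) solution; (2) it equals $1$ when $f_i=x_i^{d_i}$ for all $i$; (3) it is irreducible when the coefficients are viewed as independent variables. The determinant $\det(\mathcal{A})$ is the resultant of the ordered system of $n$ homogeneous polynomials of degree $m-1$ given by the components of $\mathcal{A}x^{m-1}$. The eigenvalues of $\mathcal{A}$ are the complex roots of the characteristic polynomial $\phi(\lambda)=\det(\mathcal{A}-\lambda\mathcal{I})$, which has degree $d=n(m-1)^{n-1}$; counted with multiplicity there are $d$ of them. *)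

theory Defs
  imports
    Complex_Main
    "HOL-Library.Poly_Mapping"
    "HOL-Computational_Algebra.Computational_Algebra"
begin

text \<open>
  Indices run over \<open>0, \<dots>, n - 1\<close> instead of \<open>1, \<dots>, n\<close>.
  Multivariate polynomials with coefficients in \<open>'a\<close> and variables in \<open>'v\<close> are
  represented by the type \<open>('v \<Rightarrow>\<^sub>0 nat) \<Rightarrow>\<^sub>0 'a\<close> of finitely supported functions on
  monomials, with the (convolution) ring structure of \<^theory>\<open>HOL-Library.Poly_Mapping\<close>.
\<close>

type_synonym ('v, 'a) mpol = "('v \<Rightarrow>\<^sub>0 nat) \<Rightarrow>\<^sub>0 'a"

definition mpol_eval :: "('v \<Rightarrow> 'a::comm_ring_1) \<Rightarrow> ('v, 'a) mpol \<Rightarrow> 'a" where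
  "mpol_eval x p =
     (\<Sum>\<mu>\<in>Poly_Mapping.keys p.
        Poly_Mapping.lookup p \<mu> * (\<Prod>v\<in>Poly_Mapping.keys \<mu>. x v ^ Poly_Mapping.lookup \<mu> v))"

definition mpol_of_int :: "('v, int) mpol \<Rightarrow> ('v, 'a::ring_1) mpol" where
  "mpol_of_int p = Poly_Mapping.map of_int p"

subsection \<open>Resultants\<close>

definition exponents :: "nat \<Rightarrow> nat \<Rightarrow> (nat \<Rightarrow>\<^sub>0 nat) set" where
  "exponents n D =
     {\<alpha>. Poly_Mapping.keys \<alpha> \<subseteq> {..<n} \<and>
         (\<Sum>j\<in>Poly_Mapping.keys \<alpha>. Poly_Mapping.lookup \<alpha> j) = D}"

definition homogeneous_form :: "nat \<Rightarrow> nat \<Rightarrow> (nat, 'a::zero) mpol \<Rightarrow> bool" where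
  "homogeneous_form n D f \<longleftrightarrow> Poly_Mapping.keys f \<subseteq> exponents n D"

text \<open>
  A polynomial in the coefficients of \<open>n\<close> forms has variables \<open>(i, \<alpha>)\<close>, standing for
  the coefficient of the monomial \<open>x\<^sup>\<alpha>\<close> in the \<open>i\<close>-th form.
\<close>

type_synonym coeff_var = "nat \<times> (nat \<Rightarrow>\<^sub>0 nat)"

definition eval_at_forms ::
    "(coeff_var, int) mpol \<Rightarrow> (nat \<Rightarrow> (nat, 'a::comm_ring_1) mpol) \<Rightarrow> 'a" where
  "eval_at_forms R F = mpol_eval (\<lambda>(i, \<alpha>). Poly_Mapping.lookup (F i) \<alpha>) (mpol_of_int R)"

text \<open>
  \<open>is_resultant n deg R\<close>: \<open>R\<close> is the resultant of \<open>n\<close> forms in \<open>n\<close> variables of degrees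
  \<open>deg 0, \<dots>, deg (n - 1)\<close>. The resultant has integer coefficients, so that it can be
  evaluated over every commutative ring; it is irreducible even over the complex numbers.
\<close>

definition is_resultant :: "nat \<Rightarrow> (nat \<Rightarrow> nat) \<Rightarrow> (coeff_var, int) mpol \<Rightarrow> bool" where
  "is_resultant n deg R \<longleftrightarrow>
     (\<forall>\<mu>\<in>Poly_Mapping.keys R. \<forall>(i, \<alpha>)\<in>Poly_Mapping.keys \<mu>. i < n \<and> \<alpha> \<in> exponents n (deg i)) \<and>
     (\<forall>F :: nat \<Rightarrow> (nat, complex) mpol. (\<forall>i<n. homogeneous_form n (deg i) (F i)) \<longrightarrow>
        (eval_at_forms R F = 0 \<longleftrightarrow>
         (\<exists>x. (\<exists>j<n. x j \<noteq> 0) \<and> (\<forall>i<n. mpol_eval x (F i) = 0)))) \<and>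
     eval_at_forms R (\<lambda>i. Poly_Mapping.single (Poly_Mapping.single i (deg i)) (1::int)) = 1 \<and>
     irreducible (mpol_of_int R :: (coeff_var, complex) mpol)"

subsection \<open>Tensors\<close>

text \<open>
  A tensor of order \<open>m\<close> and dimension \<open>n\<close> is given by a function on multi-indices
  \<open>[i\<^sub>1, \<dots>, i\<^sub>m]\<close>; only its values on \<open>multi_indices n m\<close> are relevant.
\<close>

type_synonym 'a tensor = "nat list \<Rightarrow> 'a"

definition multi_indices :: "nat \<Rightarrow> nat \<Rightarrow> nat list set" where
  "multi_indices n m = {is. set is \<subseteq> {..<n} \<and> length is = m}"

definition symmetric_tensor :: "nat \<Rightarrow> nat \<Rightarrow> 'a tensor \<Rightarrow> bool" where
  "symmetric_tensor n m A \<longleftrightarrow>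
     (\<forall>is\<in>multi_indices n m. \<forall>js\<in>multi_indices n m. mset is = mset js \<longrightarrow> A is = A js)"

definition identity_tensor :: "'a::comm_ring_1 tensor" where
  "identity_tensor is = (if \<forall>i\<in>set is. \<forall>j\<in>set is. i = j then 1 else 0)"

definition tensor_trace :: "nat \<Rightarrow> nat \<Rightarrow> 'a::comm_ring_1 tensor \<Rightarrow> 'a" where
  "tensor_trace n m A = (\<Sum>i<n. A (replicate m i))"

text \<open>
  The \<open>i\<close>-th component of \<open>A x\<^bsup>m-1\<^esup>\<close> as a polynomial in \<open>x\<^sub>0, \<dots>, x\<^bsub>n-1\<^esub>\<close>;
  \<open>\<Sum>j\<leftarrow>js. single j 1\<close> is the exponent of the monomial \<open>\<Prod>j\<leftarrow>js. x\<^sub>j\<close>.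
\<close>

definition tensor_form ::
    "nat \<Rightarrow> nat \<Rightarrow> 'a::comm_ring_1 tensor \<Rightarrow> nat \<Rightarrow> (nat, 'a) mpol" where
  "tensor_form n m A i =
     (\<Sum>js\<in>multi_indices n (m - 1).
        Poly_Mapping.single (\<Sum>j\<leftarrow>js. Poly_Mapping.single j 1) (A (i # js)))"

text \<open>In the following, \<open>R\<close> is meant to be the resultant of \<open>n\<close> forms of degree \<open>m - 1\<close>.\<close>

definition tensor_det ::
    "(coeff_var, int) mpol \<Rightarrow> nat \<Rightarrow> nat \<Rightarrow> 'a::comm_ring_1 tensor \<Rightarrow> 'a" where
  "tensor_det R n m A = eval_at_forms R (tensor_form n m A)"

text \<open>\<open>det(A - \<lambda> I)\<close> over the ring of polynomials in the indeterminate \<open>\<lambda> = [:0, 1:]\<close>.\<close>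

definition tensor_charpoly ::
    "(coeff_var, int) mpol \<Rightarrow> nat \<Rightarrow> nat \<Rightarrow> 'a::comm_ring_1 tensor \<Rightarrow> 'a poly" where
  "tensor_charpoly R n m A =
     tensor_det R n m (\<lambda>is. [:A is:] - [:0, 1:] * identity_tensor is)"

definition tensor_eigenvalues ::
    "(coeff_var, int) mpol \<Rightarrow> nat \<Rightarrow> nat \<Rightarrow> real tensor \<Rightarrow> complex multiset" where
  "tensor_eigenvalues R n m A = proots (tensor_charpoly R n m (\<lambda>is. complex_of_real (A is)))"

end

theory Submission
  imports Defs "HOL-Analysis.Convex"
begin

text \<open>
  Over the complex numbers a polynomial in one variable without zeros is constant, and a polynomial
  whose only zero is \<open>a\<close> is a multiple of a power of \<open>X - a\<close>. Applied to the determinant along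
  lines in the space of tensors, this shows:

  \<^item> the determinant is homogeneous on the plane spanned by \<open>I\<close> and \<open>A\<close>, so that the characteristic
    polynomial determines \<open>det (I + u A) = \<Prod>\<^sub>i (1 + u \<lambda>\<^sub>i)\<close>;
  \<^item> the derivative of the determinant at \<open>I\<close> vanishes in every off-diagonal direction, since the
    perturbed system \<open>x\<^sub>k\<^bsup>m-1\<^esup> = 0\<close> still has no nonzero solution;
  \<^item> in the \<open>i\<close>-th diagonal direction the determinant is \<open>(1 + u)\<^bsup>D\<^esup>\<close>, where \<open>D\<close> does not depend
    on \<open>i\<close>: \<open>diag(2, 1)\<close> and \<open>diag(1, 2)\<close> are joined by a path of nonsingular matrices.

  Comparing derivatives at \<open>u = 0\<close> gives \<open>\<Sum>\<^sub>i \<lambda>\<^sub>i = D tr(A)\<close>, the case \<open>A = I\<close> gives \<open>d = n D\<close>,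
  and the characteristic polynomial at \<open>0\<close> gives \<open>\<Prod>\<^sub>i \<lambda>\<^sub>i = det(A)\<close>. The two inequalities are then
  the inequality of arithmetic and geometric means.
\<close>

subsection \<open>Evaluation of tensor forms and determinants\<close>

text \<open>The determinant is an integer polynomial in the entries of the tensor, so it commutes
  with ring homomorphisms. Three are needed: evaluation of polynomials at a point, the embedding of
  the reals into the complex numbers, and \<open>of_int\<close>.\<close>

locale unital_ring_map =
  fixes h :: "'a::comm_ring_1 \<Rightarrow> 'b::comm_ring_1"
  assumes map_one: "h 1 = 1"
    and map_add: "h (x + y) = h x + h y"
    and map_mult: "h (x * y) = h x * h y"
begin

lemma map_zero: "h 0 = 0"
  using map_add[of 0 0] by simp

lemma map_uminus: "h (- x) = - h x"
  using map_add[of x "- x"] map_zero by (simp add: eq_neg_iff_add_eq_0 add.commute)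

lemma map_sum: "h (sum f S) = (\<Sum>x\<in>S. h (f x))"
  by (induction S rule: infinite_finite_induct) (simp_all add: map_zero map_add)

lemma map_prod: "h (prod f S) = (\<Prod>x\<in>S. h (f x))"
  by (induction S rule: infinite_finite_induct) (simp_all add: map_one map_mult)

lemma map_power: "h (x ^ k) = h x ^ k"
  by (induction k) (simp_all add: map_one map_mult)

lemma map_of_nat: "h (of_nat k) = of_nat k"
  by (induction k) (simp_all add: map_zero map_one map_add)

lemma map_of_int: "h (of_int k) = of_int k"
  by (cases k rule: int_cases2) (simp_all add: map_of_nat map_uminus)

end

lemma unital_ring_map_poly: "unital_ring_map (\<lambda>p. poly p (u::'a::comm_ring_1))"
  by unfold_locales simp_all

lemma unital_ring_map_of_real: "unital_ring_map complex_of_real"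
  by unfold_locales simp_all

lemma unital_ring_map_of_int: "unital_ring_map (of_int :: int \<Rightarrow> 'a::comm_ring_1)"
  by unfold_locales simp_all

text \<open>Summing over the monomials of \<open>R\<close> itself makes the index set independent of
  the ring. Integer coefficients that become zero in \<open>'a\<close> only contribute zero
  terms.\<close>

lemma eval_at_forms_expand:
  fixes F :: "nat \<Rightarrow> (nat, 'a::comm_ring_1) mpol"
  shows "eval_at_forms R F =
    (\<Sum>\<mu>\<in>Poly_Mapping.keys R. of_int (Poly_Mapping.lookup R \<mu>) *
       (\<Prod>v\<in>Poly_Mapping.keys \<mu>.
          Poly_Mapping.lookup (F (fst v)) (snd v) ^ Poly_Mapping.lookup \<mu> v))"
proof -
  have l: "Poly_Mapping.lookup (mpol_of_int R :: (coeff_var, 'a) mpol) \<mu>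
      = of_int (Poly_Mapping.lookup R \<mu>)" for \<mu>
    by (auto simp: mpol_of_int_def Poly_Mapping.map.rep_eq when_def)
  show ?thesis
    unfolding eval_at_forms_def mpol_eval_def l case_prod_beta
    by (rule sum.mono_neutral_left) (auto simp: l in_keys_iff)
qed

lemma (in unital_ring_map) map_eval_at_forms:
  assumes "\<And>i \<alpha>. h (Poly_Mapping.lookup (F i) \<alpha>) = Poly_Mapping.lookup (G i) \<alpha>"
  shows "h (eval_at_forms R F) = eval_at_forms R G"
  by (simp add: eval_at_forms_expand map_sum map_prod map_mult map_power map_of_int assms)

lemma finite_multi_indices: "finite (multi_indices n m)"
  unfolding multi_indices_def using finite_lists_length_eq[of "{..<n}" m] by simp

lemma lookup_tensor_form:
  "Poly_Mapping.lookup (tensor_form n m B i) \<alpha> =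
     (\<Sum>js\<in>multi_indices n (m - 1). B (i # js) when (\<Sum>j\<leftarrow>js. Poly_Mapping.single j 1) = \<alpha>)"
  by (simp add: tensor_form_def lookup_sum lookup_single)

lemma (in unital_ring_map) map_tensor_det:
  "h (tensor_det R n m B) = tensor_det R n m (\<lambda>is. h (B is))"
  unfolding tensor_det_def
  by (rule map_eval_at_forms)
     (auto simp: lookup_tensor_form map_sum when_def map_zero intro!: sum.cong)

section \<open>Evaluation of the forms of a tensor at a vector\<close>

lemma mpol_eval_superset:
  assumes "finite S" "Poly_Mapping.keys p \<subseteq> S"
  shows "mpol_eval x p = (\<Sum>\<mu>\<in>S. Poly_Mapping.lookup p \<mu> *
    (\<Prod>v\<in>Poly_Mapping.keys \<mu>. x v ^ Poly_Mapping.lookup \<mu> v))"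
  unfolding mpol_eval_def using assms
  by (intro sum.mono_neutral_left) (auto simp: in_keys_iff)

lemma mpol_eval_sum:
  assumes "finite S"
  shows "mpol_eval x (\<Sum>s\<in>S. p s) = (\<Sum>s\<in>S. mpol_eval x (p s))"
proof -
  \<comment> \<open>Monomials may cancel in the sum, so all evaluations are taken over one common
    finite set.\<close>
  define K where "K = (\<Union>s\<in>S. Poly_Mapping.keys (p s))"
  have K: "finite K" using assms by (simp add: K_def)
  have "mpol_eval x (\<Sum>s\<in>S. p s) = (\<Sum>\<mu>\<in>K. Poly_Mapping.lookup (\<Sum>s\<in>S. p s) \<mu> *
    (\<Prod>v\<in>Poly_Mapping.keys \<mu>. x v ^ Poly_Mapping.lookup \<mu> v))"
    using K keys_sum[of p S] by (intro mpol_eval_superset) (auto simp: K_def)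
  also have "\<dots> = (\<Sum>s\<in>S. \<Sum>\<mu>\<in>K. Poly_Mapping.lookup (p s) \<mu> *
    (\<Prod>v\<in>Poly_Mapping.keys \<mu>. x v ^ Poly_Mapping.lookup \<mu> v))"
    by (subst sum.swap) (simp add: lookup_sum sum_distrib_right)
  also have "\<dots> = (\<Sum>s\<in>S. mpol_eval x (p s))"
    using K by (intro sum.cong refl mpol_eval_superset[symmetric]) (auto simp: K_def)
  finally show ?thesis .
qed

lemma prod_lookup_superset:
  assumes "finite S" "Poly_Mapping.keys \<alpha> \<subseteq> S"
  shows "(\<Prod>v\<in>Poly_Mapping.keys \<alpha>. x v ^ Poly_Mapping.lookup \<alpha> v)
    = (\<Prod>v\<in>S. (x v :: 'a::comm_ring_1) ^ Poly_Mapping.lookup \<alpha> v)"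
  using assms by (intro prod.mono_neutral_left) (auto simp: in_keys_iff)

lemma keys_sum_list_single:
  "Poly_Mapping.keys (\<Sum>j\<leftarrow>js. Poly_Mapping.single j (1::nat)) \<subseteq> set js"
proof (induction js)
  case (Cons j js)
  then show ?case
    using keys_add[of "Poly_Mapping.single j (1::nat)" "\<Sum>j\<leftarrow>js. Poly_Mapping.single j 1"]
    by auto
qed simp

lemma prod_sum_list_single:
  assumes "finite S" "set js \<subseteq> S"
  shows "(\<Prod>v\<in>S. (x v :: 'a::comm_ring_1) ^
      Poly_Mapping.lookup (\<Sum>j\<leftarrow>js. Poly_Mapping.single j (1::nat)) v) = (\<Prod>j\<leftarrow>js. x j)"
  using assms(2)
proof (induction js)
  case (Cons j js)
  have "(\<Prod>v\<in>S. x v ^ (1 when j = v)) = (\<Prod>v\<in>S. if v = j then x v else 1)"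
    by (intro prod.cong) (auto simp: when_def)
  also have "\<dots> = x j" using Cons.prems assms(1) by simp
  finally show ?case
    using Cons by (simp add: lookup_add lookup_single power_add prod.distrib)
qed simp

lemma sum_lookup_sum_list_single:
  assumes "finite S" "set js \<subseteq> S"
  shows "(\<Sum>v\<in>S. Poly_Mapping.lookup (\<Sum>j\<leftarrow>js. Poly_Mapping.single j (1::nat)) v) = length js"
  using assms(2)
proof (induction js)
  case (Cons j js)
  then show ?case
    using assms(1) by (simp add: lookup_add lookup_single sum.distrib when_def)
qed simp

lemma mpol_eval_tensor_form:
  "mpol_eval x (tensor_form n m B i) = (\<Sum>js\<in>multi_indices n (m - 1). B (i # js) * (\<Prod>j\<leftarrow>js. x j))"
proof -
  have "mpol_eval x (Poly_Mapping.single (\<Sum>j\<leftarrow>js. Poly_Mapping.single j 1) b) = b * (\<Prod>j\<leftarrow>js. x j)"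
    for js b
  proof -
    let ?\<alpha> = "\<Sum>j\<leftarrow>js. Poly_Mapping.single j (1::nat)"
    have "mpol_eval x (Poly_Mapping.single ?\<alpha> b) =
      b * (\<Prod>v\<in>Poly_Mapping.keys ?\<alpha>. x v ^ Poly_Mapping.lookup ?\<alpha> v)"
      by (subst mpol_eval_superset[of "{?\<alpha>}"]) auto
    also have "\<dots> = b * (\<Prod>j\<leftarrow>js. x j)"
      using prod_lookup_superset[of "set js" ?\<alpha> x] prod_sum_list_single[of "set js" js x]
        keys_sum_list_single[of js] by simp
    finally show ?thesis .
  qed
  then show ?thesis
    unfolding tensor_form_def using finite_multi_indices
    by (simp add: mpol_eval_sum)
qed

lemma homogeneous_tensor_form: "homogeneous_form n (m - 1) (tensor_form n m B i)"
proof -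
  have *: "(\<Sum>j\<leftarrow>js. Poly_Mapping.single j 1) \<in> exponents n (m - 1)"
    if "js \<in> multi_indices n (m - 1)" for js
  proof -
    let ?\<alpha> = "\<Sum>j\<leftarrow>js. Poly_Mapping.single j (1::nat)"
    have "(\<Sum>j\<in>Poly_Mapping.keys ?\<alpha>. Poly_Mapping.lookup ?\<alpha> j)
        = (\<Sum>j\<in>set js. Poly_Mapping.lookup ?\<alpha> j)"
      using keys_sum_list_single[of js] by (intro sum.mono_neutral_left) (auto simp: in_keys_iff)
    then show ?thesis
      using that keys_sum_list_single[of js] sum_lookup_sum_list_single[of "set js" js]
      unfolding exponents_def multi_indices_def by auto
  qed
  show ?thesis
    unfolding homogeneous_form_def
  proof
    fix \<alpha> assume "\<alpha> \<in> Poly_Mapping.keys (tensor_form n m B i)"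
    then obtain js where "js \<in> multi_indices n (m - 1)"
      "\<alpha> \<in> Poly_Mapping.keys (Poly_Mapping.single (\<Sum>j\<leftarrow>js. Poly_Mapping.single j 1) (B (i # js)))"
      unfolding tensor_form_def
      using keys_sum[of "\<lambda>js. Poly_Mapping.single (\<Sum>j\<leftarrow>js. Poly_Mapping.single j 1) (B (i # js))"
          "multi_indices n (m - 1)"] by blast
    then show "\<alpha> \<in> exponents n (m - 1)"
      using * by (auto split: if_splits)
  qed
qed

lemma sum_list_replicate_single:
  "(\<Sum>j\<leftarrow>replicate k i. Poly_Mapping.single j (1::nat)) = Poly_Mapping.single i k"
proof (induction k)
  case (Suc k)
  then show ?case by (simp add: single_add[symmetric])
qed simp

lemma sum_multi_indices_replicate:
  assumes "i < n"
  shows "(\<Sum>js\<in>multi_indices n k. if js = replicate k i then f js else 0) = f (replicate k i)"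
proof -
  have "replicate k i \<in> multi_indices n k" using assms by (auto simp: multi_indices_def)
  then show ?thesis using finite_multi_indices by (simp add: sum.delta)
qed

lemma identity_tensor_Cons:
  assumes "length js = k"
  shows "identity_tensor (i # js) = (if js = replicate k i then 1 else 0)"
  using assms unfolding identity_tensor_def
  by (auto simp: replicate_eqI intro: replicate_eqI)

lemma tensor_form_identity:
  assumes "i < n"
  shows "tensor_form n m identity_tensor i = Poly_Mapping.single (Poly_Mapping.single i (m - 1)) 1"
proof -
  have "tensor_form n m identity_tensor i =
    (\<Sum>js\<in>multi_indices n (m - 1). if js = replicate (m - 1) i
       then Poly_Mapping.single (\<Sum>j\<leftarrow>js. Poly_Mapping.single j 1) 1 else 0)"
    unfolding tensor_form_def
    by (intro sum.cong refl) (auto simp: multi_indices_def identity_tensor_Cons)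
  also have "\<dots> = Poly_Mapping.single
      (\<Sum>j\<leftarrow>replicate (m - 1) i. Poly_Mapping.single j 1) 1"
    by (rule sum_multi_indices_replicate[OF assms])
  finally show ?thesis by (simp only: sum_list_replicate_single)
qed

subsection \<open>The determinant on lines of complex tensors\<close>

lemma poly_nonvanishing_degree:
  fixes p :: "complex poly"
  assumes "\<And>s. poly p s \<noteq> 0"
  shows "degree p = 0"
  using assms fundamental_theorem_of_algebra constant_degree by blast

lemma poly_nonvanishing_const:
  fixes p :: "complex poly"
  assumes "\<And>s. poly p s \<noteq> 0"
  shows "poly p s = poly p t"
  using poly_nonvanishing_degree[OF assms] by (auto elim!: degree_eq_zeroE)

text \<open>After the full power of X - a is split off, the cofactor has no zero: not at
  \<open>a\<close>, because the order is maximal, and not elsewhere, because \<open>p\<close> has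
  none there. Hence it is constant.\<close>

lemma poly_single_root_power:
  fixes p :: "complex poly"
  assumes "\<And>s. s \<noteq> a \<Longrightarrow> poly p s \<noteq> 0"
  shows "\<exists>c D. p = smult c ([:- a, 1:] ^ D)"
proof -
  have "p \<noteq> 0" using assms[of "a + 1"] by auto
  from order_decomp[OF this, of a] obtain r where
    r: "p = [:- a, 1:] ^ order a p * r" "\<not> [:- a, 1:] dvd r" by blast
  have "poly r s \<noteq> 0" for s
    using assms[of s] r by (cases "s = a") (metis poly_eq_0_iff_dvd, metis mult_zero_right poly_mult)
  then have "degree r = 0" by (rule poly_nonvanishing_degree)
  then obtain c where "r = [:c:]" by (auto elim!: degree_eq_zeroE)
  then have "p = smult c ([:- a, 1:] ^ order a p)" using r by simp
  then show ?thesis by blast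
qed

section \<open>Special tensors and directional derivatives\<close>

definition unit_tensor :: "nat list \<Rightarrow> 'a::comm_ring_1 tensor" where
  "unit_tensor js is = (if is = js then 1 else 0)"

text \<open>Encodes a matrix \<open>b\<close> as a tensor whose forms are linear in the powers
  x_j^(m-1), so that an invertible matrix leaves only the zero solution.\<close>

definition power_tensor :: "nat \<Rightarrow> nat \<Rightarrow> (nat \<Rightarrow> nat \<Rightarrow> 'a::comm_ring_1) \<Rightarrow> 'a tensor" where
  "power_tensor n m b is = (\<Sum>j<n. if tl is = replicate (m - 1) j then b (hd is) j else 0)"

text \<open>The identity matrix with the block (a, b; c, e) inserted in rows and columns
  \<open>p\<close>, \<open>q\<close>.\<close>

definition block_matrix ::
    "nat \<Rightarrow> nat \<Rightarrow> 'a \<Rightarrow> 'a \<Rightarrow> 'a \<Rightarrow> 'a \<Rightarrow> nat \<Rightarrow> nat \<Rightarrow> 'a::comm_ring_1" where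
  "block_matrix p q a b c e i j =
     (if i = p then (if j = p then a else if j = q then b else 0)
      else if i = q then (if j = p then c else if j = q then e else 0)
      else (if i = j then 1 else 0))"

text \<open>The directional derivative of the determinant at \<open>B\<close> towards
  \<open>C\<close>: the entries \<open>[:B is, C is:]\<close> represent B + t C with a formal
  parameter t.\<close>

definition tensor_det_deriv ::
    "(coeff_var, int) mpol \<Rightarrow> nat \<Rightarrow> nat \<Rightarrow> complex tensor \<Rightarrow> complex tensor \<Rightarrow> complex" where
  "tensor_det_deriv R n m B C = poly (pderiv (tensor_det R n m (\<lambda>is. [:B is, C is:]))) 0"

lemma poly_tensor_det:
  "poly (tensor_det R n m B) u = tensor_det R n m (\<lambda>is. poly (B is) u)"
  using unital_ring_map.map_tensor_det[OF unital_ring_map_poly] .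

lemma tensor_apply_power_tensor:
  "(\<Sum>js\<in>multi_indices n (m - 1). power_tensor n m b (i # js) * (\<Prod>j\<leftarrow>js. x j))
     = (\<Sum>j<n. b i j * x j ^ (m - 1))"
proof -
  have "(\<Sum>js\<in>multi_indices n (m - 1). power_tensor n m b (i # js) * (\<Prod>j\<leftarrow>js. x j))
    = (\<Sum>j<n. \<Sum>js\<in>multi_indices n (m - 1).
        if js = replicate (m - 1) j then b i j * (\<Prod>j\<leftarrow>js. x j) else 0)"
    by (subst sum.swap) (auto simp: power_tensor_def sum_distrib_right intro!: sum.cong)
  also have "\<dots> = (\<Sum>j<n. b i j * x j ^ (m - 1))"
    by (intro sum.cong refl) (simp add: sum_multi_indices_replicate)
  finally show ?thesis .
qed

lemma tensor_apply_identity: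
  assumes "i < n"
  shows "(\<Sum>js\<in>multi_indices n (m - 1). identity_tensor (i # js) * (\<Prod>j\<leftarrow>js. x j))
    = x i ^ (m - 1)"
proof -
  have "(\<Sum>js\<in>multi_indices n (m - 1). identity_tensor (i # js) * (\<Prod>j\<leftarrow>js. x j))
    = (\<Sum>js\<in>multi_indices n (m - 1). if js = replicate (m - 1) i then \<Prod>j\<leftarrow>js. x j else 0)"
    by (intro sum.cong refl) (auto simp: multi_indices_def identity_tensor_Cons)
  then show ?thesis using assms by (simp add: sum_multi_indices_replicate)
qed

lemma tensor_apply_unit_tensor:
  assumes "js \<in> multi_indices n (m - 1)"
  shows "(\<Sum>ks\<in>multi_indices n (m - 1). unit_tensor (i # js) (k # ks) * (\<Prod>j\<leftarrow>ks. x j))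
    = (if k = i then \<Prod>j\<leftarrow>js. x j else 0)"
proof -
  have "(\<Sum>ks\<in>multi_indices n (m - 1). unit_tensor (i # js) (k # ks) * (\<Prod>j\<leftarrow>ks. x j))
    = (\<Sum>ks\<in>multi_indices n (m - 1). if ks = js then if k = i then \<Prod>j\<leftarrow>js. x j else 0 else 0)"
    by (intro sum.cong refl) (auto simp: unit_tensor_def)
  then show ?thesis using assms finite_multi_indices by simp
qed

lemma sum_block_matrix:
  assumes "p < n" "q < n" "p \<noteq> q" "i < n"
  shows "(\<Sum>j<n. block_matrix p q a b c e i j * y j) =
    (if i = p then a * y p + b * y q else if i = q then c * y p + e * y q else y i)"
proof -
  have two: "(\<Sum>j<n. (if j = p then a else if j = q then b else 0) * y j) = a * y p + b * y q" for a b
  proof -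
    have "(\<Sum>j<n. (if j = p then a else if j = q then b else 0) * y j) =
      (\<Sum>j<n. (if j = p then a * y p else 0) + (if j = q then b * y q else 0))"
      using assms by (intro sum.cong) auto
    then show ?thesis using assms by (simp add: sum.distrib)
  qed
  have one: "(\<Sum>j<n. (if i = j then 1 else 0) * y j) = y i"
  proof -
    have "(\<Sum>j<n. (if i = j then 1 else 0) * y j) = (\<Sum>j<n. if i = j then y j else 0)"
      by (intro sum.cong) auto
    then show ?thesis using assms by simp
  qed
  show ?thesis
    using assms two one by (cases "i = p"; cases "i = q") (simp_all add: block_matrix_def)
qed

lemma poly_block_matrix:
  "poly (block_matrix p q a b c e i j) s =
     block_matrix p q (poly a s) (poly b s) (poly c s) (poly e s) i j"
  by (simp add: block_matrix_def)

lemma poly_power_tensor: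
  "poly (power_tensor n m b is) s = power_tensor n m (\<lambda>i j. poly (b i j) s) is"
  by (auto simp: power_tensor_def poly_sum intro!: sum.cong)

lemma pderiv_sum: "pderiv (sum f S) = (\<Sum>x\<in>S. pderiv (f x))"
  by (induction S rule: infinite_finite_induct) (simp_all add: pderiv_add)

text \<open>The product rule, arranged so that each summand contains the derivative of just one
  coefficient, as its last factor. This exposes the linear dependence on the direction.\<close>

lemma pderiv_eval_at_forms:
  fixes F :: "nat \<Rightarrow> (nat, complex poly) mpol"
  shows "pderiv (eval_at_forms R F) =
    (\<Sum>\<mu>\<in>Poly_Mapping.keys R. of_int (Poly_Mapping.lookup R \<mu>) *
       (\<Sum>v\<in>Poly_Mapping.keys \<mu>.
          (\<Prod>w\<in>Poly_Mapping.keys \<mu> - {v}. Poly_Mapping.lookup (F (fst w)) (snd w) ^ Poly_Mapping.lookup \<mu> w)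
          * (of_nat (Poly_Mapping.lookup \<mu> v) *
             Poly_Mapping.lookup (F (fst v)) (snd v) ^ (Poly_Mapping.lookup \<mu> v - 1))
          * pderiv (Poly_Mapping.lookup (F (fst v)) (snd v))))"
proof -
  have i: "pderiv (of_int k * p) = of_int k * pderiv p" for k and p :: "complex poly"
    by (simp add: of_int_poly pderiv_smult)
  have pw: "pderiv (p ^ k) = of_nat k * p ^ (k - 1) * pderiv p" for k and p :: "complex poly"
    by (simp add: pderiv_power of_nat_poly)
  show ?thesis
    unfolding eval_at_forms_expand pderiv_sum i pderiv_prod pw by (simp add: mult.assoc)
qed

declare One_nat_def [simp del]

section \<open>Consequences of the defining properties of the resultant\<close>

locale tensor_resultant =
  fixes n m :: nat and R :: "(coeff_var, int) mpol"
  assumes m: "m \<ge> 2"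
    and resultant: "is_resultant n (\<lambda>_. m - 1) R"
begin

lemma eval_at_forms_cong:
  assumes "\<And>i. i < n \<Longrightarrow> F i = G i"
  shows "eval_at_forms R F = eval_at_forms R G"
proof -
  have "fst v < n" if "\<mu> \<in> Poly_Mapping.keys R" "v \<in> Poly_Mapping.keys \<mu>" for \<mu> v
    using resultant that unfolding is_resultant_def by fastforce
  then show ?thesis
    unfolding eval_at_forms_expand using assms by (auto intro!: sum.cong prod.cong)
qed

lemma Cons_multi_indices:
  "i < n \<Longrightarrow> js \<in> multi_indices n (m - 1) \<Longrightarrow> i # js \<in> multi_indices n m"
  using m by (auto simp: multi_indices_def)

lemma multi_indices_eq_Cons:
  "multi_indices n m = (\<lambda>(i, js). i # js) ` ({..<n} \<times> multi_indices n (m - 1))"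
proof -
  have "is \<in> (\<lambda>(i, js). i # js) ` ({..<n} \<times> multi_indices n (m - 1))"
    if "is \<in> multi_indices n m" for "is"
    using that m by (cases "is") (auto simp: multi_indices_def image_iff)
  then show ?thesis using Cons_multi_indices by auto
qed

lemma tensor_det_cong:
  assumes "\<And>is. is \<in> multi_indices n m \<Longrightarrow> B is = C is"
  shows "tensor_det R n m B = tensor_det R n m C"
  unfolding tensor_det_def
  by (rule eval_at_forms_cong)
     (auto simp: tensor_form_def assms Cons_multi_indices intro!: sum.cong)

lemma tensor_det_eq_0_iff:
  fixes B :: "complex tensor"
  shows "tensor_det R n m B = 0 \<longleftrightarrow>
    (\<exists>x. (\<exists>j<n. x j \<noteq> 0) \<and>
       (\<forall>i<n. (\<Sum>js\<in>multi_indices n (m - 1). B (i # js) * (\<Prod>j\<leftarrow>js. x j)) = 0))"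
proof -
  have "eval_at_forms R F = 0 \<longleftrightarrow> (\<exists>x. (\<exists>j<n. x j \<noteq> 0) \<and> (\<forall>i<n. mpol_eval x (F i) = 0))"
    if "\<forall>i<n. homogeneous_form n (m - 1) (F i)" for F :: "nat \<Rightarrow> (nat, complex) mpol"
    using resultant that unfolding is_resultant_def by blast
  from this[of "tensor_form n m B"] show ?thesis
    by (simp add: tensor_det_def mpol_eval_tensor_form homogeneous_tensor_form)
qed

text \<open>The normalisation is postulated over the integers and is carried to every commutative
  ring along \<open>of_int\<close>.\<close>

lemma tensor_det_identity: "tensor_det R n m identity_tensor = (1 :: 'a::comm_ring_1)"
proof -
  let ?X = "\<lambda>i. Poly_Mapping.single (Poly_Mapping.single i (m - 1))"
  have "of_int (eval_at_forms R (\<lambda>i. ?X i 1)) = eval_at_forms R (\<lambda>i. ?X i (1 :: 'a))"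
    by (rule unital_ring_map.map_eval_at_forms[OF unital_ring_map_of_int])
       (simp add: lookup_single when_def)
  moreover have "eval_at_forms R (\<lambda>i. ?X i (1::int)) = 1"
    using resultant unfolding is_resultant_def by blast
  ultimately have "eval_at_forms R (\<lambda>i. ?X i (1 :: 'a)) = 1" by simp
  moreover have "tensor_det R n m identity_tensor = eval_at_forms R (\<lambda>i. ?X i (1 :: 'a))"
    unfolding tensor_det_def by (rule eval_at_forms_cong) (rule tensor_form_identity)
  ultimately show ?thesis by simp
qed

text \<open>A nonzero factor does not change the common zeros of the forms. Homogeneity of the
  determinant is not among the defining properties of the resultant and is derived from this
  fact.\<close>

lemma tensor_det_scale_eq_0_iff:
  fixes B :: "complex tensor"
  assumes "s \<noteq> 0"
  shows "tensor_det R n m (\<lambda>is. s * B is) = 0 \<longleftrightarrow> tensor_det R n m B = 0"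
  unfolding tensor_det_eq_0_iff using assms
  by (simp add: mult.assoc sum_distrib_left[symmetric])

lemma tensor_det_poly_const:
  fixes B :: "nat list \<Rightarrow> complex poly"
  assumes "\<And>s. tensor_det R n m (\<lambda>is. poly (B is) s) \<noteq> 0"
  shows "tensor_det R n m (\<lambda>is. poly (B is) s) = tensor_det R n m (\<lambda>is. poly (B is) t)"
  using assms poly_nonvanishing_const[of "tensor_det R n m B" s t]
  by (simp add: poly_tensor_det)

text \<open>For almost every \<open>u\<close> the left-hand side is a monomial in \<open>s\<close>; hence the product of any two
  distinct coefficients vanishes identically in \<open>u\<close>, and \<open>D\<close> is the same for all \<open>u\<close>.\<close>

lemma tensor_det_identity_plus_scale:
  fixes A :: "complex tensor"
  defines "q \<equiv> tensor_det R n m (\<lambda>is. [:identity_tensor is, A is:])"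
  obtains D where "\<And>s u. tensor_det R n m (\<lambda>is. s * (identity_tensor is + u * A is)) = s ^ D * poly q u"
proof -
  \<comment> \<open>The determinant of s (I + u A) with both parameters formal: the outer variable
    is s, the inner one is u.\<close>
  define H where "H = tensor_det R n m (\<lambda>is. [:0, [:identity_tensor is, A is:]:])"
  have H: "poly (poly H [:s:]) u = tensor_det R n m (\<lambda>is. s * (identity_tensor is + u * A is))" for s u
    by (simp add: H_def poly_tensor_det algebra_simps)
  have q: "poly q u = tensor_det R n m (\<lambda>is. identity_tensor is + u * A is)" for u
    by (simp add: q_def poly_tensor_det)
  have Hq: "poly (poly H 1) u = poly q u" for u
    using H[of 1 u] by (simp add: q one_pCons)
  have q0: "poly q 0 = 1" by (simp add: q tensor_det_identity)
  have mp: "poly (map_poly (\<lambda>p. poly p u) G) s = poly (poly G [:s:]) u" for G :: "complex poly poly" and s u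
    by (induction G) (simp_all add: map_poly_pCons)
  have mono: "\<exists>c D. map_poly (\<lambda>p. poly p u) H = monom c D" if "poly q u \<noteq> 0" for u
  proof -
    have "poly (map_poly (\<lambda>p. poly p u) H) s \<noteq> 0" if "s \<noteq> 0" for s
      using \<open>poly q u \<noteq> 0\<close> that by (simp add: mp H tensor_det_scale_eq_0_iff q)
    then show ?thesis
      using poly_single_root_power[of 0 "map_poly (\<lambda>p. poly p u) H"] by (simp add: monom_altdef)
  qed
  have orth: "coeff H k * coeff H l = 0" if "k \<noteq> l" for k l
  proof -
    \<comment> \<open>The monomial shape is known only where \<open>q\<close> does not vanish. The
      extra factor \<open>q\<close> covers the remaining points and is cancelled afterwards, since
      \<open>q\<close> has value 1 at 0.\<close>
    have "poly (coeff H k * coeff H l * q) u = 0" for u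
    proof (cases "poly q u = 0")
      case False
      then obtain c D where "map_poly (\<lambda>p. poly p u) H = monom c D" using mono by blast
      then have "poly (coeff H k) u = coeff (monom c D) k" for k
        by (metis coeff_map_poly poly_0)
      then show ?thesis using that by auto
    qed simp
    then have "coeff H k * coeff H l * q = 0" using poly_all_0_iff_0 by blast
    then show ?thesis using q0 by auto
  qed
  have "H \<noteq> 0" using Hq[of 0] q0 by auto
  define D where "D = degree H"
  \<comment> \<open>The leading coefficient is nonzero, so orthogonality kills all the
    others.\<close>
  have "coeff H k = 0" if "k \<noteq> D" for k
    using orth[OF that] \<open>H \<noteq> 0\<close> by (simp add: D_def)
  then have HD: "H = monom (coeff H D) D"
    by (intro poly_eqI) auto
  have "poly (coeff H D) u = poly q u" for u
    using Hq[of u] by (subst (asm) HD) (simp add: poly_monom)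
  moreover have "poly (poly H [:s:]) u = s ^ D * poly (coeff H D) u" for s u
    by (subst HD) (simp add: poly_monom)
  ultimately have "tensor_det R n m (\<lambda>is. s * (identity_tensor is + u * A is)) = s ^ D * poly q u" for s u
    by (simp add: H)
  then show thesis by (rule that)
qed

section \<open>The derivative of the determinant at the identity tensor\<close>

text \<open>By the chain rule the direction enters only through the coefficients of its forms, and
  these are linear in its entries.\<close>

lemma tensor_det_deriv_linear:
  "tensor_det_deriv R n m B C =
    (\<Sum>is\<in>multi_indices n m. C is * tensor_det_deriv R n m B (unit_tensor is))"
proof -
  define P where "P \<mu> v =
    (\<Prod>w\<in>Poly_Mapping.keys \<mu> - {v}.
       Poly_Mapping.lookup (tensor_form n m B (fst w)) (snd w) ^ Poly_Mapping.lookup \<mu> w)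
    * (of_nat (Poly_Mapping.lookup \<mu> v) *
       Poly_Mapping.lookup (tensor_form n m B (fst v)) (snd v) ^ (Poly_Mapping.lookup \<mu> v - 1))"
    for \<mu> v
  have deriv: "tensor_det_deriv R n m B C =
    (\<Sum>\<mu>\<in>Poly_Mapping.keys R. of_int (Poly_Mapping.lookup R \<mu>) *
       (\<Sum>v\<in>Poly_Mapping.keys \<mu>. P \<mu> v * Poly_Mapping.lookup (tensor_form n m C (fst v)) (snd v)))"
    for C
  proof -
    have "poly (Poly_Mapping.lookup (tensor_form n m (\<lambda>is. [:B is, C is:]) i) \<alpha>) 0 =
      Poly_Mapping.lookup (tensor_form n m B i) \<alpha>" for i \<alpha>
      by (auto simp: lookup_tensor_form poly_sum when_def intro!: sum.cong)
    moreover have "poly (pderiv (Poly_Mapping.lookup (tensor_form n m (\<lambda>is. [:B is, C is:]) i) \<alpha>)) 0 =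
      Poly_Mapping.lookup (tensor_form n m C i) \<alpha>" for i \<alpha>
      by (auto simp: lookup_tensor_form poly_sum pderiv_sum pderiv_pCons when_def intro!: sum.cong)
    ultimately show ?thesis
      by (simp add: tensor_det_deriv_def tensor_det_def pderiv_eval_at_forms P_def poly_sum poly_prod)
  qed
  have lin: "Poly_Mapping.lookup (tensor_form n m C i) \<alpha> =
    (\<Sum>is\<in>multi_indices n m. C is * Poly_Mapping.lookup (tensor_form n m (unit_tensor is) i) \<alpha>)"
    if "i < n" for i \<alpha>
  proof -
    have "(\<Sum>is\<in>multi_indices n m. C is * Poly_Mapping.lookup (tensor_form n m (unit_tensor is) i) \<alpha>) =
      (\<Sum>js\<in>multi_indices n (m - 1). \<Sum>is\<in>multi_indices n m.
         if is = i # js then (C is when (\<Sum>j\<leftarrow>js. Poly_Mapping.single j 1) = \<alpha>) else 0)"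
      by (subst sum.swap)
         (auto simp: lookup_tensor_form unit_tensor_def sum_distrib_left when_def intro!: sum.cong)
    also have "\<dots> = Poly_Mapping.lookup (tensor_form n m C i) \<alpha>"
      using that by (auto simp: lookup_tensor_form finite_multi_indices Cons_multi_indices intro!: sum.cong)
    finally show ?thesis by simp
  qed
  have v: "fst v < n" if "\<mu> \<in> Poly_Mapping.keys R" "v \<in> Poly_Mapping.keys \<mu>" for \<mu> v
    using resultant that unfolding is_resultant_def by fastforce
  have "(\<Sum>is\<in>multi_indices n m. C is * tensor_det_deriv R n m B (unit_tensor is)) =
    (\<Sum>\<mu>\<in>Poly_Mapping.keys R. of_int (Poly_Mapping.lookup R \<mu>) *
       (\<Sum>v\<in>Poly_Mapping.keys \<mu>. P \<mu> v * (\<Sum>is\<in>multi_indices n m. C is *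
          Poly_Mapping.lookup (tensor_form n m (unit_tensor is) (fst v)) (snd v))))"
    unfolding deriv sum_distrib_left
    by (subst sum.swap, intro sum.cong refl, subst sum.swap) (simp add: mult_ac)
  also have "\<dots> = tensor_det_deriv R n m B C"
    unfolding deriv by (intro sum.cong arg_cong2[of _ _ _ _ "(*)"] refl lin[symmetric] v)
  finally show ?thesis by simp
qed

lemma tensor_apply_identity_plus_unit_tensor:
  assumes "js \<in> multi_indices n (m - 1)" "k < n"
  shows "(\<Sum>ks\<in>multi_indices n (m - 1).
      (identity_tensor (k # ks) + u * unit_tensor (i # js) (k # ks)) * (\<Prod>j\<leftarrow>ks. x j))
    = (x k :: complex) ^ (m - 1) + u * (if k = i then \<Prod>j\<leftarrow>js. x j else 0)"
  using tensor_apply_identity[OF assms(2), where m = m and x = x] tensor_apply_unit_tensor[OF assms(1), where i = i and k = k and x = x]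
  by (simp add: ring_distribs sum.distrib sum_distrib_left[symmetric] mult.assoc)

text \<open>Some index l in \<open>js\<close> differs from i. The l-th equation is unperturbed and
  forces x_l = 0, which removes the perturbation from the i-th equation. So the determinant has no
  zero on this line and is constant.\<close>

lemma tensor_det_deriv_off_diagonal:
  assumes js: "js \<in> multi_indices n (m - 1)" and "js \<noteq> replicate (m - 1) i"
  shows "tensor_det_deriv R n m identity_tensor (unit_tensor (i # js)) = 0"
proof -
  let ?p = "tensor_det R n m (\<lambda>is. [:identity_tensor is, unit_tensor (i # js) is:]) :: complex poly"
  obtain l where l: "l \<in> set js" "l \<noteq> i"
    using assms by (metis (mono_tags, lifting) mem_Collect_eq multi_indices_def replicate_eqI)
  then have "l < n" using js by (auto simp: multi_indices_def)
  have "poly ?p u \<noteq> 0" for u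
  proof
    assume "poly ?p u = 0"
    then have "\<exists>x. (\<exists>j<n. x j \<noteq> 0) \<and>
      (\<forall>k<n. x k ^ (m - 1) + u * (if k = i then \<Prod>j\<leftarrow>js. x j else 0) = 0)"
      by (simp add: poly_tensor_det tensor_det_eq_0_iff
            tensor_apply_identity_plus_unit_tensor[OF js] cong: conj_cong)
    then obtain x where x: "\<exists>j<n. x j \<noteq> 0"
      "\<And>k. k < n \<Longrightarrow> x k ^ (m - 1) + u * (if k = i then \<Prod>j\<leftarrow>js. x j else 0) = 0"
      by blast
    have "x l = 0" using x(2)[OF \<open>l < n\<close>] l by simp
    then have "(\<Prod>j\<leftarrow>js. x j) = 0" using l by (auto simp: prod_list_zero_iff)
    then have "x k = 0" if "k < n" for k using x(2)[OF that] by (auto split: if_splits)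
    then show False using x(1) by blast
  qed
  then have "degree ?p = 0" by (rule poly_nonvanishing_degree)
  then obtain c where "?p = [:c:]" by (auto elim: degree_eq_zeroE)
  then show ?thesis by (simp add: tensor_det_deriv_def pderiv_pCons)
qed

text \<open>The i-th equation becomes (1 + u) x_i^(m-1) = 0, so -1 is the only possible zero; the
  value at u = 0 fixes the constant factor. The exponent may still depend on i here.\<close>

lemma tensor_det_diagonal:
  assumes "i < n"
  obtains D where "tensor_det R n m (\<lambda>is. [:identity_tensor is, unit_tensor (replicate m i) is:])
    = ([:1, 1:] ^ D :: complex poly)"
proof -
  let ?js = "replicate (m - 1) i"
  let ?p = "tensor_det R n m (\<lambda>is. [:identity_tensor is, unit_tensor (replicate m i) is:]) :: complex poly"
  have js: "?js \<in> multi_indices n (m - 1)" using assms by (auto simp: multi_indices_def)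
  have rep: "replicate m i = i # ?js" using m by (cases m) auto
  have "poly ?p u \<noteq> 0" if "u \<noteq> - 1" for u
  proof
    assume "poly ?p u = 0"
    then have "\<exists>x. (\<exists>j<n. x j \<noteq> 0) \<and>
      (\<forall>k<n. x k ^ (m - 1) + u * (if k = i then \<Prod>j\<leftarrow>?js. x j else 0) = 0)"
      unfolding rep
      by (simp add: poly_tensor_det tensor_det_eq_0_iff
            tensor_apply_identity_plus_unit_tensor[OF js] del: map_replicate)
    then obtain x where x: "\<exists>j<n. x j \<noteq> 0"
      "\<And>k. k < n \<Longrightarrow> x k ^ (m - 1) + u * (if k = i then \<Prod>j\<leftarrow>?js. x j else 0) = 0"
      by blast
    have "x k = 0" if "k < n" for k
    proof (cases "k = i")
      case True
      have "(1 + u) * x i ^ (m - 1) = 0" using x(2)[OF that] True by (simp add: algebra_simps)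
      moreover have "1 + u \<noteq> 0" using \<open>u \<noteq> - 1\<close> by (metis add_eq_0_iff)
      ultimately show ?thesis using True by simp
    qed (use x(2)[OF that] in auto)
    then show False using x(1) by blast
  qed
  then obtain c D where D: "?p = smult c ([:1, 1:] ^ D)"
    using poly_single_root_power[of "- 1" ?p] by auto
  have "poly ?p 0 = 1" by (simp add: poly_tensor_det tensor_det_identity)
  then have "c = 1" by (simp add: D)
  then show thesis using D that by simp
qed

lemma tensor_det_block_nonzero:
  fixes a b c e :: complex
  assumes pq: "p < n" "q < n" "p \<noteq> q" and det: "a * e - b * c \<noteq> 0"
  shows "tensor_det R n m (power_tensor n m (block_matrix p q a b c e)) \<noteq> 0"
proof
  assume "tensor_det R n m (power_tensor n m (block_matrix p q a b c e)) = 0"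
  then have "\<exists>x. (\<exists>j<n. x j \<noteq> 0) \<and> (\<forall>i<n.
     (if i = p then a * x p ^ (m - 1) + b * x q ^ (m - 1)
      else if i = q then c * x p ^ (m - 1) + e * x q ^ (m - 1) else x i ^ (m - 1)) = 0)"
    by (simp add: tensor_det_eq_0_iff tensor_apply_power_tensor sum_block_matrix[OF pq])
  then obtain x where x: "\<exists>j<n. x j \<noteq> 0" and
    eq: "\<And>i. i < n \<Longrightarrow> (if i = p then a * x p ^ (m - 1) + b * x q ^ (m - 1)
      else if i = q then c * x p ^ (m - 1) + e * x q ^ (m - 1) else x i ^ (m - 1)) = 0"
    by blast
  have 1: "a * x p ^ (m - 1) + b * x q ^ (m - 1) = 0" using eq[OF pq(1)] by simp
  have 2: "c * x p ^ (m - 1) + e * x q ^ (m - 1) = 0" using eq[OF pq(2)] pq(3) by simp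
  \<comment> \<open>Cramer's rule for the unknowns x_p^(m-1) and x_q^(m-1).\<close>
  have lin: "(a * e - b * c) * y = e * (a * y + b * z) - b * (c * y + e * z)"
    "(a * e - b * c) * z = a * (c * y + e * z) - c * (a * y + b * z)" for y z
    by (simp_all add: algebra_simps)
  have "(a * e - b * c) * x p ^ (m - 1) = 0" "(a * e - b * c) * x q ^ (m - 1) = 0"
    using lin(1)[of "x p ^ (m - 1)" "x q ^ (m - 1)"] lin(2)[of "x q ^ (m - 1)" "x p ^ (m - 1)"]
    unfolding 1 2 by (simp_all only: mult_zero_right diff_zero)
  then have "x p = 0" "x q = 0" using det by auto
  then have "x k = 0" if "k < n" for k using eq[OF that] by (auto split: if_splits)
  then show False using x by blast
qed

text \<open>Both sides are joined by a path of nonsingular matrices that consists of three segments,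
  and along each of them the determinant is a polynomial without zeros.\<close>

lemma tensor_det_block_swap:
  assumes pq: "p < n" "q < n" "p \<noteq> q"
  shows "tensor_det R n m (power_tensor n m (block_matrix p q 2 0 0 1))
    = (tensor_det R n m (power_tensor n m (block_matrix p q 1 0 0 2)) :: complex)"
proof -
  have line: "tensor_det R n m (power_tensor n m
        (block_matrix p q (poly a s) (poly b s) (poly c s) (poly e s))) =
      tensor_det R n m (power_tensor n m
        (block_matrix p q (poly a t) (poly b t) (poly c t) (poly e t)))"
    if "\<And>s. poly a s * poly e s - poly b s * poly c s \<noteq> 0" for a b c e :: "complex poly" and s t
    using tensor_det_poly_const[of "power_tensor n m (block_matrix p q a b c e)" s t]
      tensor_det_block_nonzero[OF pq that]
    by (simp add: poly_power_tensor poly_block_matrix)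
  \<comment> \<open>The direct segment diag(2 - s, 1 + s) is singular at s = 2 and s = -1. The three
    segments used instead, (2, s; 0, 1), (2 - s, 1 - s; s, 1 + s) and (1, 0; s, 2), have matrix
    determinant 2 for every complex s.\<close>
  have 1: "tensor_det R n m (power_tensor n m (block_matrix p q 2 0 0 1)) =
      (tensor_det R n m (power_tensor n m (block_matrix p q 2 1 0 1)) :: complex)"
    using line[of "[:2:]" "[:1:]" "[:0, 1:]" "[:0:]" 0 1] by simp
  have 2: "tensor_det R n m (power_tensor n m (block_matrix p q 2 1 0 1)) =
      (tensor_det R n m (power_tensor n m (block_matrix p q 1 0 1 2)) :: complex)"
    using line[of "[:2, -1:]" "[:1, 1:]" "[:1, -1:]" "[:0, 1:]" 0 1]
    by (simp add: algebra_simps)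
  have 3: "tensor_det R n m (power_tensor n m (block_matrix p q 1 0 1 2)) =
      (tensor_det R n m (power_tensor n m (block_matrix p q 1 0 0 2)) :: complex)"
    using line[of "[:1:]" "[:2:]" "[:0:]" "[:0, 1:]" 1 0] by simp
  show ?thesis using 1 2 3 by simp
qed

lemma tensor_det_block_diagonal:
  assumes pq: "p < n" "q < n" "p \<noteq> q"
  shows "tensor_det R n m (power_tensor n m (block_matrix p q (1 + u) 0 0 1)) =
    (tensor_det R n m (\<lambda>is. identity_tensor is + u * unit_tensor (replicate m p) is) :: complex)"
proof (rule tensor_det_cong)
  fix "is" assume "is \<in> multi_indices n m"
  then obtain i js where ijs: "is = i # js" "i < n" "length js = m - 1"
    by (auto simp: multi_indices_eq_Cons) (auto simp: multi_indices_def)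
  have rep: "replicate m p = p # replicate (m - 1) p" using m by (cases m) auto
  have "power_tensor n m (block_matrix p q (1 + u) 0 0 1) is =
    (\<Sum>j<n. if j = i then if js = replicate (m - 1) i then if i = p then 1 + u else 1 else 0 else 0)"
    unfolding power_tensor_def ijs using pq by (intro sum.cong) (auto simp: block_matrix_def)
  also have "\<dots> = (if js = replicate (m - 1) i then if i = p then 1 + u else 1 else 0)"
    using ijs by simp
  finally show "power_tensor n m (block_matrix p q (1 + u) 0 0 1) is =
      identity_tensor is + u * unit_tensor (replicate m p) is"
    unfolding rep using ijs by (auto simp: identity_tensor_Cons unit_tensor_def)
qed

text \<open>At u = 1 the powers (1 + u)^D become powers of 2, which determine their exponents; the
  swap of the two diagonal blocks then makes the exponents agree. The derivative of (1 + u)^D at 0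
  is D.\<close>

lemma tensor_det_deriv_diagonal:
  obtains D where "\<And>i. i < n \<Longrightarrow>
    tensor_det_deriv R n m identity_tensor (unit_tensor (replicate m i)) = of_nat D"
proof -
  have "\<exists>D. tensor_det R n m (\<lambda>is. [:identity_tensor is, unit_tensor (replicate m i) is:])
    = ([:1, 1:] ^ D :: complex poly)" if "i < n" for i
    using tensor_det_diagonal[OF that] by blast
  then obtain D where D: "\<And>i. i < n \<Longrightarrow>
    tensor_det R n m (\<lambda>is. [:identity_tensor is, unit_tensor (replicate m i) is:])
      = ([:1, 1:] ^ D i :: complex poly)" by metis
  have D2: "tensor_det R n m (power_tensor n m (block_matrix p q 2 0 0 1)) = (2 ^ D p :: complex)"
    if "p < n" "q < n" "p \<noteq> q" for p q
    using tensor_det_block_diagonal[OF that, of 1] arg_cong[OF D[OF that(1)], of "\<lambda>p. poly p 1"]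
    by (simp add: poly_tensor_det poly_power)
  have "D p = D q" if "p < n" "q < n" for p q
  proof (cases "p = q")
    case False
    have "block_matrix p q 1 0 0 2 = (block_matrix q p 2 0 0 1 :: nat \<Rightarrow> nat \<Rightarrow> complex)"
      using False by (auto simp: block_matrix_def fun_eq_iff)
    then have "(2::complex) ^ D p = 2 ^ D q"
      using tensor_det_block_swap[OF that False] D2[OF that False] D2[OF that(2,1)] False by auto
    then have "of_nat (2 ^ D p) = (of_nat (2 ^ D q) :: complex)" by simp
    then show ?thesis by (simp only: of_nat_eq_iff) simp
  qed simp
  moreover have "tensor_det_deriv R n m identity_tensor (unit_tensor (replicate m i)) = of_nat (D i)"
    if "i < n" for i
    using D[OF that] by (simp add: tensor_det_deriv_def pderiv_power pderiv_pCons)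
  ultimately have "tensor_det_deriv R n m identity_tensor (unit_tensor (replicate m i)) = of_nat (D 0)"
    if "i < n" for i
    using that by (metis gr_zeroI less_zeroE order_less_trans)
  then show thesis by (rule that)
qed

text \<open>By linearity only the diagonal directions survive, all with the same weight.\<close>

lemma tensor_det_deriv_trace:
  obtains D where "\<And>C. tensor_det_deriv R n m identity_tensor C = of_nat D * tensor_trace n m C"
proof -
  obtain D where D: "\<And>i. i < n \<Longrightarrow>
    tensor_det_deriv R n m identity_tensor (unit_tensor (replicate m i)) = of_nat D"
    using tensor_det_deriv_diagonal by blast
  have rep: "replicate m p = p # replicate (m - 1) p" for p using m by (cases m) auto
  have inj: "inj_on (\<lambda>(i, js). i # js) ({..<n} \<times> multi_indices n (m - 1))"
    by (auto simp: inj_on_def)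
  have "tensor_det_deriv R n m identity_tensor C = of_nat D * tensor_trace n m C" for C
  proof -
    have "tensor_det_deriv R n m identity_tensor C =
      (\<Sum>i<n. \<Sum>js\<in>multi_indices n (m - 1).
         C (i # js) * tensor_det_deriv R n m identity_tensor (unit_tensor (i # js)))"
      by (subst tensor_det_deriv_linear, subst multi_indices_eq_Cons, subst sum.reindex[OF inj])
         (simp add: sum.cartesian_product case_prod_beta)
    also have "\<dots> = (\<Sum>i<n. \<Sum>js\<in>multi_indices n (m - 1).
         if js = replicate (m - 1) i then C (i # js) * of_nat D else 0)"
      using D by (intro sum.cong refl) (auto simp: tensor_det_deriv_off_diagonal rep)
    also have "\<dots> = (\<Sum>i<n. C (i # replicate (m - 1) i) * of_nat D)"
      by (intro sum.cong refl) (simp add: sum_multi_indices_replicate)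
    finally show ?thesis
      by (simp add: tensor_trace_def rep sum_distrib_left mult.commute)
  qed
  then show thesis by (rule that)
qed

end

section \<open>Product and sum of the eigenvalues\<close>

lemma (in tensor_resultant) tensor_charpoly_complex_roots:
  fixes B :: "complex tensor" and ev :: "nat \<Rightarrow> complex"
  assumes roots: "proots (tensor_charpoly R n m B) = {#ev i. i \<in># mset_set {1..d}#}"
    and "d \<ge> 1"
  shows "tensor_det R n m B = (\<Prod>i=1..d. ev i)"
    and "\<exists>D. d = D * n \<and> (\<Sum>i=1..d. ev i) = of_nat D * tensor_trace n m B"
proof -
  define C where "C = lead_coeff (tensor_charpoly R n m B)"
  have pc: "tensor_charpoly R n m B = smult C (\<Prod>i=1..d. [:- ev i, 1:])"
    using complex_poly_decompose_multiset[of "tensor_charpoly R n m B"]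
    unfolding roots C_def by (simp add: image_mset.compositionality o_def prod_unfold_prod_mset)
  have pcp: "poly (tensor_charpoly R n m B) u = tensor_det R n m (\<lambda>is. B is - u * identity_tensor is)" for u
    unfolding tensor_charpoly_def poly_tensor_det
    by (rule arg_cong[of _ _ "tensor_det R n m"]) (auto simp: identity_tensor_def)
  define q where "q = tensor_det R n m (\<lambda>is. [:identity_tensor is, B is:])"
  obtain D where D: "\<And>s u. tensor_det R n m (\<lambda>is. s * (identity_tensor is + u * B is)) = s ^ D * poly q u"
    using tensor_det_identity_plus_scale[of B] unfolding q_def by blast
  have q0: "poly q 0 = 1" by (simp add: q_def poly_tensor_det tensor_det_identity)
  \<comment> \<open>The reversed characteristic polynomial: r(u) = u^d phi(-1/u) for nonzero u. Its
    constant factor is not yet known to be 1.\<close>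
  define r where "r = smult (C * (- 1) ^ d) (\<Prod>i=1..d. [:1, ev i:])"
  have "u ^ D * poly r u = u ^ d * poly q u" if "u \<noteq> 0" for u
  proof -
    have "(\<lambda>is. B is - (- 1 / u) * identity_tensor is) = (\<lambda>is. (1 / u) * (identity_tensor is + u * B is))"
      using that by (auto simp: fun_eq_iff field_simps)
    then have "poly (tensor_charpoly R n m B) (- 1 / u) = (1 / u) ^ D * poly q u"
      unfolding pcp using D[of "1 / u" u] by simp
    moreover have "poly (tensor_charpoly R n m B) (- 1 / u) = (1 / u) ^ d * poly r u"
    proof -
      have "(\<Prod>i=1..d. - ev i + - 1 / u) = (\<Prod>i=1..d. (- 1 / u) * (1 + u * ev i))"
        using that by (intro prod.cong) (auto simp: field_simps)
      also have "\<dots> = (- 1 / u) ^ d * (\<Prod>i=1..d. 1 + u * ev i)"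
        by (simp only: prod.distrib prod_constant) simp
      also have "(- 1 / u) ^ d = (- 1) ^ d * (1 / u) ^ d"
        by (simp add: power_mult_distrib[symmetric])
      finally show ?thesis by (simp add: pc r_def poly_prod mult_ac)
    qed
    ultimately show ?thesis
      using that by (simp add: field_simps) (metis mult.commute mult.left_commute)
  qed
  \<comment> \<open>The extra factor X makes the identity hold at u = 0 as well.\<close>
  then have "poly ([:0, 1:] * [:0, 1:] ^ D * r) u = poly ([:0, 1:] * [:0, 1:] ^ d * q) u" for u
    by (cases "u = 0") (simp_all add: poly_power)
  then have "[:0, 1:] * [:0, 1:] ^ D * r = [:0, 1:] * [:0, 1:] ^ d * q"
    using poly_eq_poly_eq_iff by blast
  then have eq: "[:0, 1:] ^ D * r = [:0, 1:] ^ d * q"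
    by (simp only: mult.assoc mult_left_cancel[of "[:0, 1 :: complex:]"]) simp
  have "q \<noteq> 0" using q0 by auto
  then have "r \<noteq> 0" using eq by auto
  then have r0: "poly r 0 \<noteq> 0" by (auto simp: r_def poly_prod)
  \<comment> \<open>Neither \<open>r\<close> nor \<open>q\<close> vanishes at 0, so comparing the
    orders of the zero at 0 gives D = d.\<close>
  have X: "order 0 ([:0, 1 :: complex:] ^ k) = k" for k
    using order_power_n_n[of "0::complex" k] by simp
  have "order 0 ([:0, 1:] ^ D * r) = D" using r0 \<open>r \<noteq> 0\<close> by (simp add: order_mult X order_0I)
  moreover have "order 0 ([:0, 1:] ^ d * q) = d" using q0 \<open>q \<noteq> 0\<close> by (simp add: order_mult X order_0I)
  ultimately have "D = d" using eq by simp
  then have "r = q" using eq by simp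
  then have "poly r 0 = 1" using q0 by simp
  then have C: "C * (- 1) ^ d = 1" by (simp add: r_def poly_prod)
  then have q: "q = (\<Prod>i=1..d. [:1, ev i:])" using \<open>r = q\<close> by (simp add: r_def)
  have "tensor_det R n m B = poly (tensor_charpoly R n m B) 0" by (simp add: pcp)
  also have "\<dots> = C * (\<Prod>i=1..d. (- 1) * ev i)" by (simp add: pc poly_prod)
  also have "\<dots> = C * (- 1) ^ d * (\<Prod>i=1..d. ev i)" by (simp only: prod.distrib prod_constant) simp
  finally show "tensor_det R n m B = (\<Prod>i=1..d. ev i)" using C by simp
  obtain E where E: "\<And>C. tensor_det_deriv R n m identity_tensor C = of_nat E * tensor_trace n m C"
    using tensor_det_deriv_trace by blast
  \<comment> \<open>Homogeneity with s = 1 + u at the identity tensor. Since the identity has trace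
    n, its derivative d equals E n.\<close>
  have "tensor_det R n m (\<lambda>is. [:identity_tensor is, identity_tensor is:]) = ([:1, 1:] ^ d :: complex poly)"
  proof -
    have "poly (tensor_det R n m (\<lambda>is. [:identity_tensor is, identity_tensor is:])) u = poly ([:1, 1:] ^ d) u" for u :: complex
      using D[of "1 + u" 0] by (simp add: poly_tensor_det q0 \<open>D = d\<close> poly_power algebra_simps)
    then show ?thesis using poly_eq_poly_eq_iff by blast
  qed
  then have "tensor_det_deriv R n m identity_tensor identity_tensor = of_nat d"
    by (simp add: tensor_det_deriv_def pderiv_power pderiv_pCons)
  then have "(of_nat d :: complex) = of_nat (E * n)"
    by (simp add: E tensor_trace_def identity_tensor_def)
  then have "d = E * n" by (simp only: of_nat_eq_iff)
  \<comment> \<open>The sum of the \<open>ev i\<close> is the coefficient of u in the product of the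
    factors 1 + u \<open>ev i\<close>.\<close>
  moreover have "(\<Sum>i=1..d. ev i) = tensor_det_deriv R n m identity_tensor B"
    by (simp add: tensor_det_deriv_def q_def[symmetric] q pderiv_prod poly_sum poly_prod pderiv_pCons)
  ultimately show "\<exists>D. d = D * n \<and> (\<Sum>i=1..d. ev i) = of_nat D * tensor_trace n m B"
    using E by metis
qed

subsection \<open>The inequalities\<close>

lemma prod_le_mean_power:
  fixes x :: "'a \<Rightarrow> real"
  assumes "finite S" "S \<noteq> {}" "\<And>i. i \<in> S \<Longrightarrow> x i \<ge> 0"
  shows "(\<Prod>i\<in>S. x i) \<le> ((\<Sum>i\<in>S. x i) / card S) ^ card S"
proof -
  have c: "card S > 0" using assms by (simp add: card_gt_0_iff)
  have P: "0 \<le> (\<Prod>i\<in>S. x i)" using assms by (simp add: prod_nonneg)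
  have "(\<Prod>i\<in>S. x i) powr (1 / card S) \<le> (\<Sum>i\<in>S. x i) / card S"
    using arith_geom_mean[OF assms] by (simp add: sum_divide_distrib)
  then have "((\<Prod>i\<in>S. x i) powr (1 / card S)) ^ card S \<le> ((\<Sum>i\<in>S. x i) / card S) ^ card S"
    by (rule power_mono) simp
  moreover have "((\<Prod>i\<in>S. x i) powr (1 / card S)) ^ card S = (\<Prod>i\<in>S. x i)"
    using P c by (simp add: powr_powr flip: powr_realpow')
  ultimately show ?thesis by simp
qed

text \<open>The arithmetic-geometric mean inequality on \<open>S\<close>, with the sum over
  \<open>S\<close> enlarged to the total sum, bounds the product over \<open>S\<close> from above.
  Dividing the total product by that bound leaves a lower bound for the product over
  \<open>U\<close>.\<close>

lemma prod_subset_mean_bound: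
  fixes x :: "'a \<Rightarrow> real"
  assumes "finite S" "finite U" "S \<inter> U = {}" "S \<noteq> {}"
    and pos: "\<And>i. i \<in> S \<union> U \<Longrightarrow> x i > 0"
  shows "(real (card S) / (\<Sum>i\<in>S \<union> U. x i)) ^ card S * (\<Prod>i\<in>S \<union> U. x i) \<le> (\<Prod>i\<in>U. x i)"
proof -
  define T where "T = (\<Sum>i\<in>S \<union> U. x i)"
  have T: "T > 0" unfolding T_def using assms by (intro sum_pos) auto
  have c: "card S > 0" using assms by (simp add: card_gt_0_iff)
  have U: "(\<Prod>i\<in>U. x i) > 0" using pos by (intro prod_pos) auto
  have "(\<Prod>i\<in>S. x i) \<le> ((\<Sum>i\<in>S. x i) / card S) ^ card S"
    using assms by (intro prod_le_mean_power) (auto intro: less_imp_le)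
  also have "\<dots> \<le> (T / card S) ^ card S"
  proof (intro power_mono divide_right_mono)
    show "(\<Sum>i\<in>S. x i) \<le> T" unfolding T_def
      using assms by (intro sum_mono2) (auto intro: less_imp_le)
    show "0 \<le> (\<Sum>i\<in>S. x i) / card S"
      using pos by (intro divide_nonneg_nonneg sum_nonneg) (auto intro: less_imp_le)
  qed simp
  finally have "(card S / T) ^ card S * (\<Prod>i\<in>S. x i) \<le> (card S / T) ^ card S * (T / card S) ^ card S"
    using T by (intro mult_left_mono) auto
  also have "\<dots> = 1" using T c by (simp add: power_mult_distrib[symmetric])
  finally have "(card S / T) ^ card S * (\<Prod>i\<in>S. x i) * (\<Prod>i\<in>U. x i) \<le> 1 * (\<Prod>i\<in>U. x i)"
    using U by (intro mult_right_mono) auto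
  then show ?thesis
    using assms by (simp add: T_def prod.union_disjoint mult.assoc)
qed

theorem theorem3p1:
  fixes n m d k :: nat
    and R :: "(coeff_var, int) mpol"
    and A :: "real tensor"
    and ev :: "nat \<Rightarrow> real"
  assumes "m \<ge> 2" and "even m" and "n \<ge> 1"
    and "is_resultant n (\<lambda>_. m - 1) R"
    and "symmetric_tensor n m A"
    and "d = n * (m - 1) ^ (n - 1)"
    and "tensor_eigenvalues R n m A = {#complex_of_real (ev i). i \<in># mset_set {1..d}#}"
    and "\<And>i j. 1 \<le> i \<Longrightarrow> i \<le> j \<Longrightarrow> j \<le> d \<Longrightarrow> ev j \<le> ev i"
    and "ev d > 0"
    and "1 \<le> k" and "k \<le> d - 1"
  shows "(\<Sum>i=1..k. ev i)
           \<le> real ((m - 1) ^ (n - 1)) * tensor_trace n m A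
             - real (d - k) *
               ((real k / (real ((m - 1) ^ (n - 1)) * tensor_trace n m A)) ^ k
                  * tensor_det R n m A) powr (1 / real (d - k))
         \<and> (\<Prod>i=d-k+1..d. ev i)
           \<ge> (real (d - k) / (real ((m - 1) ^ (n - 1)) * tensor_trace n m A)) ^ (d - k)
              * tensor_det R n m A"
proof -
  interpret tensor_resultant n m R by unfold_locales fact+
  have k: "1 \<le> k" "k < d" using \<open>1 \<le> k\<close> \<open>k \<le> d - 1\<close> by auto
  have pos: "ev i > 0" if "i \<in> {1..d}" for i
    using assms(8)[of i d] \<open>ev d > 0\<close> that by auto
  let ?A = "\<lambda>is. complex_of_real (A is)"
  have roots: "proots (tensor_charpoly R n m ?A) = {#complex_of_real (ev i). i \<in># mset_set {1..d}#}"
    using assms(7) by (simp add: tensor_eigenvalues_def)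
  have "complex_of_real (tensor_det R n m A) = tensor_det R n m ?A"
    by (rule unital_ring_map.map_tensor_det[OF unital_ring_map_of_real])
  also have "\<dots> = of_real (\<Prod>i=1..d. ev i)"
    using tensor_charpoly_complex_roots(1)[OF roots] k by simp
  finally have det: "tensor_det R n m A = (\<Prod>i=1..d. ev i)" by (simp only: of_real_eq_iff)
  obtain D where D: "d = D * n"
    "(\<Sum>i=1..d. complex_of_real (ev i)) = of_nat D * tensor_trace n m ?A"
    using tensor_charpoly_complex_roots(2)[OF roots] k by auto
  \<comment> \<open>The weight of the trace is found by cancelling n in D n = n (m-1)^(n-1).\<close>
  have "D = (m - 1) ^ (n - 1)" using D(1) assms(6) \<open>n \<ge> 1\<close> by simp
  then have "complex_of_real (\<Sum>i=1..d. ev i) =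
      of_real (real ((m - 1) ^ (n - 1)) * tensor_trace n m A)"
    using D(2) by (simp add: tensor_trace_def)
  then have tr: "real ((m - 1) ^ (n - 1)) * tensor_trace n m A = (\<Sum>i=1..d. ev i)"
    by (simp only: of_real_eq_iff)
  have split: "{1..d} = {1..k} \<union> {k+1..d}" "{1..d} = {1..d-k} \<union> {d-k+1..d}"
    using k by auto
  have "(real (d - k) / (\<Sum>i=1..d. ev i)) ^ (d - k) * (\<Prod>i=1..d. ev i) \<le> (\<Prod>i=d-k+1..d. ev i)"
    using prod_subset_mean_bound[of "{1..d-k}" "{d-k+1..d}" ev, folded split(2)] pos k
    by simp
  moreover have "(\<Sum>i=1..k. ev i) \<le> (\<Sum>i=1..d. ev i) -
    real (d - k) * ((real k / (\<Sum>i=1..d. ev i)) ^ k * (\<Prod>i=1..d. ev i)) powr (1 / real (d - k))"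
  proof -
    \<comment> \<open>The same bound with the first k eigenvalues as \<open>S\<close>. Its (d-k)-th
      root is then at most the arithmetic mean of the last d - k eigenvalues.\<close>
    have "(real k / (\<Sum>i=1..d. ev i)) ^ k * (\<Prod>i=1..d. ev i) \<le> (\<Prod>i=k+1..d. ev i)"
      using prod_subset_mean_bound[of "{1..k}" "{k+1..d}" ev, folded split(1)] pos k
      by simp
    moreover have "0 \<le> (real k / (\<Sum>i=1..d. ev i)) ^ k * (\<Prod>i=1..d. ev i)"
      using pos by (intro mult_nonneg_nonneg zero_le_power divide_nonneg_nonneg sum_nonneg prod_nonneg)
        (auto intro: less_imp_le)
    ultimately have "((real k / (\<Sum>i=1..d. ev i)) ^ k * (\<Prod>i=1..d. ev i)) powr (1 / real (d - k))
        \<le> (\<Prod>i=k+1..d. ev i) powr (1 / real (d - k))"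
      by (intro powr_mono2) auto
    also have "\<dots> \<le> (\<Sum>i=k+1..d. ev i) / real (d - k)"
      using arith_geom_mean[of "{k+1..d}" ev] pos k
      by (simp add: less_imp_le sum_divide_distrib)
    finally have "real (d - k) * ((real k / (\<Sum>i=1..d. ev i)) ^ k * (\<Prod>i=1..d. ev i)) powr (1 / real (d - k))
        \<le> (\<Sum>i=k+1..d. ev i)"
      using k by (simp add: field_simps)
    moreover have "(\<Sum>i=1..d. ev i) = (\<Sum>i=1..k. ev i) + (\<Sum>i=k+1..d. ev i)"
      unfolding split(1) by (rule sum.union_disjoint) auto
    ultimately show ?thesis by simp
  qed
  ultimately show ?thesis unfolding tr det by blast
qed

end
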